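(* Let $\beta>0$, $M>0$, and let $W\in C(\mathbb T^d)$ be radially symmetric. Then the problem $$\inf_{\varrho\in\mathcal A_M}\mathcal F_\beta(\varrho)$$ admits a global minimizer, i.e. there is $\varrho\in\mathcal A_M$ with $\mathcal F_\beta(\varrho)=\inf_{\mathcal A_M}\mathcal F_\beta$.
   Context: $\mathbb T^d=\mathbb R^d/\mathbb Z^d$; $W\ast\varrho$ is the periodic convolution $\int_{\mathbb T^d}W(x-z)\varrho(z)\,\mathrm dz$. "Radially symmetric" means that $W(x)$ depends only on the distance of $x$ to $0$ in $\mathbb T^d$ (in particular $W$ is even). The free energy is $$\mathcal F_\beta(\varrho)=\int_{\mathbb T^d}\varrho(\log\varrho-1)\,\mathrm dx-\beta\int_{\mathbb T^d}\varrho\,(W\ast\varrho)\,\mathrm dx ,$$ with $0\log0=0$, and the admissible class is $$\mathcal A_M=\left\{\varrho\in L^1(\mathbb T^d):\ \varrho\ge0,\ \int_{\mathbb T^d}\varrho\,\mathrm dx=M,\ \int_{\mathbb T^d}\varrho\log\varrho\,\mathrm dx<+\infty\right\}.$$ *)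

theory Defs
  imports "HOL-Analysis.Analysis"
begin

text \<open>Functions on the torus \<open>\<real>\<^sup>d / \<int>\<^sup>d\<close> are represented by \<open>\<int>\<^sup>d\<close>-periodic functions on
  \<open>\<real>\<^sup>d\<close>; integrals over the torus are Lebesgue integrals over the unit cube.\<close>

definition int_lattice :: "(real ^ 'd) set"
  where "int_lattice = {k. \<forall>i. k $ i \<in> \<int>}"

definition torus_periodic :: "(real ^ 'd \<Rightarrow> 'a) \<Rightarrow> bool"
  where "torus_periodic f \<longleftrightarrow> (\<forall>x. \<forall>k\<in>int_lattice. f (x + k) = f x)"

definition unit_cube :: "(real ^ 'd) set"
  where "unit_cube = cbox 0 1"

definition torus_integral :: "(real ^ 'd \<Rightarrow> real) \<Rightarrow> real"
  where "torus_integral f = (LINT x:unit_cube|lebesgue. f x)"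

definition torus_C :: "(real ^ 'd \<Rightarrow> real) set"
  where "torus_C = {f. torus_periodic f \<and> continuous_on UNIV f}"

definition torus_L1 :: "(real ^ 'd \<Rightarrow> real) set"
  where "torus_L1 = {f. torus_periodic f \<and> set_integrable lebesgue unit_cube f}"

text \<open>\<open>infdist x int_lattice\<close> is the distance from the class of \<open>x\<close> to \<open>0\<close> in the quotient metric.\<close>

definition radially_symmetric :: "(real ^ 'd \<Rightarrow> real) \<Rightarrow> bool"
  where "radially_symmetric W \<longleftrightarrow>
    (\<forall>x y. infdist x int_lattice = infdist y int_lattice \<longrightarrow> W x = W y)"

definition torus_convolution ::
    "(real ^ 'd \<Rightarrow> real) \<Rightarrow> (real ^ 'd \<Rightarrow> real) \<Rightarrow> real ^ 'd \<Rightarrow> real"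
  where "torus_convolution W \<rho> x = torus_integral (\<lambda>z. W (x - z) * \<rho> z)"

definition free_energy :: "real \<Rightarrow> (real ^ 'd \<Rightarrow> real) \<Rightarrow> (real ^ 'd \<Rightarrow> real) \<Rightarrow> real"
  where "free_energy \<beta> W \<rho> =
    torus_integral (\<lambda>x. \<rho> x * (ln (\<rho> x) - 1))
      - \<beta> * torus_integral (\<lambda>x. \<rho> x * torus_convolution W \<rho> x)"

text \<open>Since \<open>t * ln t \<ge> - exp (- 1)\<close> for \<open>t \<ge> 0\<close> and the cube has finite measure, the integral of
  \<open>\<rho> log \<rho>\<close> always exists in \<open>(-\<infinity>, +\<infinity>]\<close>, and it is \<open>< +\<infinity>\<close> exactly when \<open>\<rho> log \<rho>\<close> is
  integrable. As the Bochner integral of a non-integrable function is \<open>0\<close>, the condition is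
  expressed as integrability.\<close>

definition admissible :: "real \<Rightarrow> (real ^ 'd \<Rightarrow> real) set"
  where "admissible M = {\<rho> \<in> torus_L1.
    (AE x in lebesgue. 0 \<le> \<rho> x) \<and>
    torus_integral \<rho> = M \<and>
    set_integrable lebesgue unit_cube (\<lambda>x. \<rho> x * ln (\<rho> x))}"

end

theory Submission
  imports Defs "HOL-Complex_Analysis.Great_Picard"
begin

text \<open>A minimizing sequence \<open>\<rho>\<^sub>n\<close> has a subsequence that is Cauchy in \<open>L\<^sup>1\<close>, so no weak compactness is needed.
  By Arzela--Ascoli, \<open>W * \<rho>\<^sub>n\<close> converges uniformly along a subsequence to some \<open>u\<close>, and, after passing
  to a further subsequence, \<open>\<integral> u \<rho>\<^sub>n\<close> converges to some \<open>c\<close>. Hence all mixed interactions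
  \<open>\<integral> \<rho>\<^sub>i (W * \<rho>\<^sub>j)\<close> tend to \<open>c\<close> as \<open>i, j \<rightarrow> \<infinity>\<close>, and the interaction energy of the midpoint
  \<open>(\<rho>\<^sub>i + \<rho>\<^sub>j) / 2\<close> does too. The energy of the midpoint is at least the infimum, so its entropy is not much
  smaller than the mean of the entropies of \<open>\<rho>\<^sub>i\<close> and \<open>\<rho>\<^sub>j\<close>; uniform convexity of the entropy then
  forces \<open>\<rho>\<^sub>i - \<rho>\<^sub>j \<rightarrow> 0\<close> in \<open>L\<^sup>1\<close>. In the limit the interaction converges and the entropy is
  lower semicontinuous by Fatou's lemma.\<close>

section \<open>Uniform convexity of the entropy density\<close>

definition entropy_density :: "real \<Rightarrow> real"
  where "entropy_density t = t * (ln t - 1)"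

text \<open>The derivative of \<open>entropy_density\<close> is \<open>ln\<close>, so the left side
  is the gap between the function and its tangent at \<open>m\<close>, that is
  \<open>a * ln (a / m) - a + m\<close> for positive \<open>a\<close>. The remainder is a squared
  Hellinger distance, which makes the convexity quantitative.\<close>

lemma entropy_density_tangent:
  assumes "0 \<le> a" "0 < m"
  shows "entropy_density a - entropy_density m - (a - m) * ln m \<ge> (sqrt a - sqrt m)\<^sup>2"
proof (cases "a = 0")
  case True
  then show ?thesis using assms by (simp add: entropy_density_def algebra_simps)
next
  case False
  then have a: "0 < a" using assms by simp
  define p q where "p = sqrt a" and "q = sqrt m"
  have pq: "0 < p" "0 < q" "a = p\<^sup>2" "m = q\<^sup>2"
    using a assms by (auto simp: p_def q_def)
  \<comment> \<open>\<open>ln y \<le> y - 1\<close> applied to \<open>y = sqrt (m / a)\<close> rather than \<open>m / a\<close> leaves the square as remainder.\<close>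
  have "ln (q / p) \<le> q / p - 1"
    using pq by (intro ln_le_minus_one) simp
  then have "ln q - ln p \<le> q / p - 1"
    using pq by (simp add: ln_div)
  then have "2 * p\<^sup>2 * (ln q - ln p) \<le> 2 * p\<^sup>2 * (q / p - 1)"
    by (intro mult_left_mono) auto
  also have "\<dots> = 2 * p * q - 2 * p\<^sup>2"
    using pq by (simp add: field_simps power2_eq_square)
  finally have "2 * p\<^sup>2 * (ln q - ln p) \<le> 2 * p * q - 2 * p\<^sup>2" .
  moreover have "ln a = 2 * ln p" "ln m = 2 * ln q"
    using pq by (auto simp: ln_realpow)
  ultimately show ?thesis
    unfolding entropy_density_def p_def[symmetric] q_def[symmetric]
    using pq by (simp add: algebra_simps power2_eq_square)
qed

text \<open>The tangent at \<open>1\<close> is horizontal, with value \<open>- 1\<close>. This bound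
  is what later makes \<open>entropy_density + 1\<close> an admissible integrand for Fatou's
  lemma.\<close>

lemma entropy_density_ge: "0 \<le> t \<Longrightarrow> - 1 \<le> entropy_density t"
  using order_trans[OF zero_le_power2 entropy_density_tangent[of t 1]]
  by (simp add: entropy_density_def)

text \<open>Adding the tangent estimates for \<open>a\<close> and \<open>b\<close> at their midpoint
  cancels the linear terms. The tangent needs a positive base point, hence the separate case
  \<open>a + b = 0\<close>.\<close>

lemma entropy_density_midpoint:
  assumes "0 \<le> a" "0 \<le> b"
  shows "(sqrt a - sqrt ((a + b) / 2))\<^sup>2 + (sqrt b - sqrt ((a + b) / 2))\<^sup>2
    \<le> entropy_density a + entropy_density b - 2 * entropy_density ((a + b) / 2)"
proof (cases "a + b = 0")
  case True
  then have "a = 0" "b = 0" using assms by auto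
  then show ?thesis by (simp add: entropy_density_def)
next
  case False
  define m where "m = (a + b) / 2"
  have "0 < m" and b: "b = 2 * m - a" using False assms by (auto simp: m_def field_simps)
  with entropy_density_tangent[of a m] entropy_density_tangent[of b m] assms
  show ?thesis
    unfolding m_def[symmetric] by (auto simp: algebra_simps b)
qed

text \<open>Young's inequality with weight \<open>t\<close>, applied to the factorization of
  \<open>a - m\<close> as a difference of squares of \<open>sqrt a\<close> and
  \<open>sqrt m\<close>.\<close>

lemma abs_diff_le_sqrt_diff:
  fixes a m t :: real
  assumes "0 \<le> a" "0 \<le> m" "0 < t"
  shows "\<bar>a - m\<bar> \<le> (sqrt a - sqrt m)\<^sup>2 / (2 * t) + t * (a + m)"
proof -
  define p q where "p = sqrt a" and "q = sqrt m"
  have pq: "0 \<le> p" "0 \<le> q" "a = p\<^sup>2" "m = q\<^sup>2"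
    using assms by (auto simp: p_def q_def)
  have "2 * t * \<bar>a - m\<bar> = 2 * \<bar>p - q\<bar> * (t * (p + q))"
    using pq by (simp add: power2_eq_square square_diff_square_factored abs_mult)
  also have "\<dots> \<le> (p - q)\<^sup>2 + t\<^sup>2 * (p + q)\<^sup>2"
    using sum_squares_bound[of "\<bar>p - q\<bar>" "t * (p + q)"] by (simp add: power_mult_distrib)
  also have "\<dots> \<le> (p - q)\<^sup>2 + t\<^sup>2 * (2 * (p\<^sup>2 + q\<^sup>2))"
    using sum_squares_bound[of p q]
    by (intro add_left_mono mult_left_mono) (auto simp: power2_eq_square algebra_simps)
  also have "\<dots> = 2 * t * ((p - q)\<^sup>2 / (2 * t) + t * (a + m))"
    using assms pq by (simp add: field_simps power2_eq_square)
  finally show ?thesis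
    using assms unfolding p_def q_def by simp
qed

text \<open>Both points are compared with their midpoint. The parameter \<open>t\<close> stays free:
  the last term integrates to a multiple of \<open>t\<close> times the mass, so it can be made small
  before the entropy gap is.\<close>

lemma abs_diff_le_entropy_gap:
  assumes "0 \<le> a" "0 \<le> b" "0 < t"
  shows "\<bar>a - b\<bar> \<le> (entropy_density a + entropy_density b - 2 * entropy_density ((a + b) / 2)) / (2 * t)
    + 2 * t * (a + b)"
proof -
  define m where "m = (a + b) / 2"
  have m: "0 \<le> m" "a + b = 2 * m" using assms by (auto simp: m_def)
  have "t * (a + m) + t * (b + m) = t * (a + b + 2 * m)"
    by (simp add: algebra_simps)
  then have tm: "t * (a + m) + t * (b + m) = 2 * t * (a + b)"
    unfolding m(2)[symmetric] by simp
  have "\<bar>a - b\<bar> \<le> \<bar>a - m\<bar> + \<bar>b - m\<bar>" by linarith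
  also have "\<dots> \<le> ((sqrt a - sqrt m)\<^sup>2 / (2 * t) + t * (a + m)) + ((sqrt b - sqrt m)\<^sup>2 / (2 * t) + t * (b + m))"
    using assms m by (intro add_mono abs_diff_le_sqrt_diff) auto
  also have "\<dots> = ((sqrt a - sqrt m)\<^sup>2 + (sqrt b - sqrt m)\<^sup>2) / (2 * t) + 2 * t * (a + b)"
    using tm by (simp add: add_divide_distrib)
  also have "\<dots> \<le> (entropy_density a + entropy_density b - 2 * entropy_density m) / (2 * t)
    + 2 * t * (a + b)"
    using entropy_density_midpoint[OF assms(1,2)] assms(3) unfolding m_def[symmetric]
    by (simp add: divide_right_mono)
  finally show ?thesis unfolding m_def .
qed

text \<open>Only the point \<open>0\<close> needs care: the factor \<open>t\<close> gives the value
  \<open>0\<close> there, which agrees with the limit from the right.\<close>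

lemma continuous_on_entropy_density: "continuous_on {0..} entropy_density"
proof -
  have "((\<lambda>t::real. t * (ln t - 1)) \<longlongrightarrow> 0) (at_right 0)"
    by real_asymp
  then have "continuous (at 0 within {0..}) entropy_density"
    unfolding continuous_within entropy_density_def
    by (simp add: at_within_Ici_at_right)
  moreover have "isCont entropy_density x" if "0 < x" for x
    unfolding entropy_density_def using that by (intro continuous_intros) auto
  ultimately show ?thesis
    unfolding continuous_on_eq_continuous_within
    by (metis atLeast_iff continuous_at_imp_continuous_at_within order_le_less)
qed

lemma borel_measurable_entropy_density [measurable]: "entropy_density \<in> borel_measurable borel"
  unfolding entropy_density_def by measurable

section \<open>Fatou's lemma and completeness of \<open>L\<^sup>1\<close>\<close>

text \<open>Integrability of the limit is concluded and not assumed: without it the bound on the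
  Bochner integral, which defaults to \<open>0\<close>, would carry no information.\<close>

lemma Fatou_real:
  fixes u :: "nat \<Rightarrow> 'a \<Rightarrow> real"
  assumes u: "\<And>n. integrable M (u n)" and pos: "\<And>n. AE x in M. 0 \<le> u n x"
    and lim: "AE x in M. (\<lambda>n. u n x) \<longlonglongrightarrow> v x"
    and v[measurable]: "v \<in> borel_measurable M"
    and le: "eventually (\<lambda>n. (\<integral>x. u n x \<partial>M) \<le> C) sequentially"
  shows "integrable M v" and "(\<integral>x. v x \<partial>M) \<le> C"
proof -
  have [measurable]: "u n \<in> borel_measurable M" for n using u by auto
  have "AE x in M. \<forall>n. 0 \<le> u n x" using pos by (simp add: AE_all_countable)
  with lim have lim': "AE x in M. ennreal (v x) = liminf (\<lambda>n. ennreal (u n x)) \<and> 0 \<le> v x"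
  proof eventually_elim
    case (elim x)
    then have "(\<lambda>n. ennreal (u n x)) \<longlonglongrightarrow> ennreal (v x)" by (intro tendsto_ennrealI)
    then have "liminf (\<lambda>n. ennreal (u n x)) = ennreal (v x)"
      by (rule lim_imp_Liminf[OF trivial_limit_sequentially])
    moreover have "0 \<le> v x"
      using elim by (auto intro: LIMSEQ_le_const)
    ultimately show ?case by simp
  qed
  \<comment> \<open>Nonnegativity of \<open>C\<close> is needed at the end, because
    \<open>ennreal\<close> truncates negative numbers to \<open>0\<close>.\<close>
  obtain n where "(\<integral>x. u n x \<partial>M) \<le> C"
    using le by (auto simp: eventually_sequentially)
  then have C: "0 \<le> C"
    using integral_nonneg_AE[OF pos[of n]] by linarith
  have "(\<integral>\<^sup>+x. ennreal (v x) \<partial>M) = (\<integral>\<^sup>+x. liminf (\<lambda>n. ennreal (u n x)) \<partial>M)"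
    using lim' by (intro nn_integral_cong_AE) auto
  also have "\<dots> \<le> liminf (\<lambda>n. \<integral>\<^sup>+x. ennreal (u n x) \<partial>M)"
    by (intro nn_integral_liminf) auto
  also have "\<dots> = liminf (\<lambda>n. ennreal (\<integral>x. u n x \<partial>M))"
    using u pos by (simp add: nn_integral_eq_integral)
  also have "\<dots> \<le> liminf (\<lambda>n::nat. ennreal C)"
    using le by (intro Liminf_mono) (auto elim!: eventually_mono intro: ennreal_leI)
  finally have *: "(\<integral>\<^sup>+x. ennreal (v x) \<partial>M) \<le> ennreal C"
    by (simp add: Liminf_const)
  show **: "integrable M v"
    using * lim' by (intro integrableI_nonneg) (auto intro: le_less_trans)
  have "(\<integral>\<^sup>+x. ennreal (v x) \<partial>M) = ennreal (\<integral>x. v x \<partial>M)"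
    using ** lim' by (intro nn_integral_eq_integral) auto
  with * C show "(\<integral>x. v x \<partial>M) \<le> C" by simp
qed

text \<open>The value \<open>0\<close> at points of divergence makes the limit periodic at every point, not only
  almost everywhere.\<close>

definition seq_limit :: "(nat \<Rightarrow> 'a \<Rightarrow> real) \<Rightarrow> 'a \<Rightarrow> real"
  where "seq_limit s x = (if convergent (\<lambda>n. s n x) then lim (\<lambda>n. s n x) else 0)"

text \<open>A subsequence is Cauchy almost everywhere, and Fatou's lemma turns its pointwise limit
  into an \<open>L\<^sup>1\<close> limit. The limit is given explicitly as \<open>seq_limit\<close>,
  so that properties holding at every point can be transferred to it.\<close>

lemma L1_Cauchy_converges:
  fixes s :: "nat \<Rightarrow> 'a \<Rightarrow> real"
  assumes int: "\<And>n. integrable M (s n)"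
    and Cauchy: "\<And>e. e > 0 \<Longrightarrow> \<exists>N. \<forall>i\<ge>N. \<forall>j\<ge>N. (\<integral>x. \<bar>s i x - s j x\<bar> \<partial>M) < e"
  obtains r where "strict_mono r"
    and "integrable M (seq_limit (s \<circ> r))"
    and "AE x in M. (\<lambda>n. s (r n) x) \<longlonglongrightarrow> seq_limit (s \<circ> r) x"
    and "(\<lambda>n. \<integral>x. \<bar>s (r n) x - seq_limit (s \<circ> r) x\<bar> \<partial>M) \<longlonglongrightarrow> 0"
proof -
  obtain r where r: "strict_mono r" and ae: "AE x in M. Cauchy (\<lambda>i. s (r i) x)"
    by (rule cauchy_L1_AE_cauchy_subseq[of M s]) (use int Cauchy in auto)
  define g where "g = seq_limit (s \<circ> r)"
  have [measurable]: "s n \<in> borel_measurable M" for n using int by auto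
  \<comment> \<open>Convergence is rewritten as the Cauchy property, whose measurability is derived
    automatically.\<close>
  have g_meas [measurable]: "g \<in> borel_measurable M"
    unfolding g_def seq_limit_def comp_def Cauchy_convergent_iff[symmetric] by measurable
  have lim: "AE x in M. (\<lambda>n. s (r n) x) \<longlonglongrightarrow> g x"
    using ae by eventually_elim (simp add: g_def seq_limit_def Cauchy_convergent_iff convergent_LIMSEQ_iff)
  \<comment> \<open>Fatou's lemma as \<open>j\<close> tends to infinity, with \<open>i\<close>
    fixed.\<close>
  have L1: "integrable M (\<lambda>x. \<bar>s (r i) x - g x\<bar>) \<and> (\<integral>x. \<bar>s (r i) x - g x\<bar> \<partial>M) \<le> e"
    if "e > 0" and N: "\<forall>i\<ge>N. \<forall>j\<ge>N. (\<integral>x. \<bar>s i x - s j x\<bar> \<partial>M) < e" and "N \<le> i" for e N i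
  proof -
    have "eventually (\<lambda>j. (\<integral>x. \<bar>s (r i) x - s (r j) x\<bar> \<partial>M) \<le> e) sequentially"
      using eventually_ge_at_top[of N]
    proof eventually_elim
      case (elim j)
      then have "N \<le> r i" "N \<le> r j"
        using \<open>N \<le> i\<close> seq_suble[OF r, of i] seq_suble[OF r, of j] by linarith+
      then show ?case using N by (simp add: less_imp_le)
    qed
    moreover have "AE x in M. (\<lambda>j. \<bar>s (r i) x - s (r j) x\<bar>) \<longlonglongrightarrow> \<bar>s (r i) x - g x\<bar>"
      using lim by eventually_elim (intro tendsto_intros)
    ultimately show ?thesis
      using Fatou_real[of M "\<lambda>j x. \<bar>s (r i) x - s (r j) x\<bar>" "\<lambda>x. \<bar>s (r i) x - g x\<bar>" e] int by simp
  qed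
  obtain N where N: "\<forall>i\<ge>N. \<forall>j\<ge>N. (\<integral>x. \<bar>s i x - s j x\<bar> \<partial>M) < 1"
    using Cauchy[of 1] by auto
  have "integrable M (\<lambda>x. s (r N) x - g x)"
    using L1[OF _ N, of N] by (simp add: integrable_abs_iff)
  then have "integrable M (\<lambda>x. s (r N) x - (s (r N) x - g x))"
    by (rule Bochner_Integration.integrable_diff[OF int])
  then have gi: "integrable M g" by (simp only: diff_diff_eq2 add_diff_cancel_left')
  have "(\<lambda>n. \<integral>x. \<bar>s (r n) x - g x\<bar> \<partial>M) \<longlonglongrightarrow> 0"
  proof (rule LIMSEQ_I)
    fix e :: real assume "e > 0"
    then obtain N where "\<forall>i\<ge>N. \<forall>j\<ge>N. (\<integral>x. \<bar>s i x - s j x\<bar> \<partial>M) < e / 2"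
      using Cauchy[of "e / 2"] by auto
    with L1[of "e / 2" N] \<open>e > 0\<close>
    show "\<exists>N. \<forall>n\<ge>N. norm ((\<integral>x. \<bar>s (r n) x - g x\<bar> \<partial>M) - 0) < e"
      by (intro exI[of _ N]) (fastforce simp: integral_nonneg_AE)
  qed
  with r gi lim show thesis using that unfolding g_def by blast
qed

text \<open>The pairing of a bounded function with an \<open>L\<^sup>1\<close> function; all
  estimates for convolutions and interactions below are instances.\<close>

lemma integrable_bounded_mult:
  fixes g h :: "'a \<Rightarrow> real"
  assumes g: "integrable M g" and h [measurable]: "h \<in> borel_measurable M"
    and C: "\<And>x. x \<in> space M \<Longrightarrow> \<bar>h x\<bar> \<le> C"
  shows "integrable M (\<lambda>x. h x * g x)"
    and "\<bar>\<integral>x. h x * g x \<partial>M\<bar> \<le> C * (\<integral>x. \<bar>g x\<bar> \<partial>M)"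
proof -
  have le: "\<bar>h x * g x\<bar> \<le> C * \<bar>g x\<bar>" if "x \<in> space M" for x
    using C[OF that] by (simp add: abs_mult mult_right_mono)
  have gi: "integrable M (\<lambda>x. C * \<bar>g x\<bar>)" using g by simp
  have [measurable]: "g \<in> borel_measurable M" using g by auto
  show "integrable M (\<lambda>x. h x * g x)"
    using le by (intro Bochner_Integration.integrable_bound[OF gi]) (auto intro!: AE_I2 intro: order_trans[OF _ abs_ge_self])
  have "\<bar>\<integral>x. h x * g x \<partial>M\<bar> \<le> (\<integral>x. \<bar>h x * g x\<bar> \<partial>M)"
    by (rule integral_abs_bound)
  also have "\<dots> \<le> (\<integral>x. C * \<bar>g x\<bar> \<partial>M)"
    by (rule Bochner_Integration.integral_mono[OF integrable_abs gi le]) fact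
  finally show "\<bar>\<integral>x. h x * g x \<partial>M\<bar> \<le> C * (\<integral>x. \<bar>g x\<bar> \<partial>M)" by simp
qed

section \<open>The unit cube as a probability space\<close>

abbreviation torus_measure :: "(real ^ 'd) measure"
  where "torus_measure \<equiv> lebesgue_on unit_cube"

lemma unit_cube_lmeasurable: "unit_cube \<in> lmeasurable"
  by (simp add: unit_cube_def)

lemma unit_cube_sets: "unit_cube \<in> sets lebesgue"
  by (simp add: unit_cube_def)

lemma compact_unit_cube: "compact unit_cube"
  by (simp add: unit_cube_def)

lemma finite_measure_torus_measure: "finite_measure torus_measure"
  by (intro finite_measure_lebesgue_on unit_cube_lmeasurable)

lemma torus_integral_eq: "torus_integral f = integral\<^sup>L torus_measure f"
  by (simp add: torus_integral_def set_lebesgue_integral_def integral_restrict_space unit_cube_sets)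

lemma set_integrable_unit_cube: "set_integrable lebesgue unit_cube f \<longleftrightarrow> integrable torus_measure f"
  for f :: "real ^ 'd \<Rightarrow> real"
  by (simp add: set_integrable_def integrable_restrict_space unit_cube_sets)

lemma measure_torus_measure: "measure torus_measure unit_cube = 1"
proof -
  have "(0::real^'d) \<in> cbox 0 1" by (simp add: mem_box_cart)
  then have "measure lborel (cbox (0::real^'d) 1) = 1"
    by (subst content_cbox_cart) auto
  then show ?thesis
    by (simp add: unit_cube_def measure_restrict_space space_restrict_space)
qed

lemma AE_torus_measure: "AE x in lebesgue. P x \<Longrightarrow> AE x in torus_measure. P x"
  by (auto simp: AE_restrict_space_iff unit_cube_sets elim!: eventually_mono)

section \<open>The interaction as a bilinear form and its compactness\<close>

text \<open>The two densities are kept apart because the argument needs the off-diagonal values. The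
  convolution stands on the left as the bounded factor, in the shape of
  \<open>integrable_bounded_mult\<close>.\<close>

definition interaction :: "(real ^ 'd \<Rightarrow> real) \<Rightarrow> (real ^ 'd \<Rightarrow> real) \<Rightarrow> (real ^ 'd \<Rightarrow> real) \<Rightarrow> real"
  where "interaction W \<sigma> \<tau> = (\<integral>x. torus_convolution W \<tau> x * \<sigma> x \<partial>torus_measure)"

locale torus_kernel =
  fixes W :: "real ^ 'd \<Rightarrow> real"
  assumes continuous_W: "continuous_on UNIV W"
begin

lemma uniformly_continuous_kernel:
  "uniformly_continuous_on (unit_cube \<times> unit_cube) (\<lambda>p. W (fst p - snd p))"
  by (intro compact_uniformly_continuous compact_Times compact_unit_cube)
    (intro continuous_on_compose2[OF continuous_W] continuous_intros subset_UNIV)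

definition kernel_bound :: real
  where "kernel_bound = (SOME C. 0 < C \<and> (\<forall>x\<in>unit_cube. \<forall>z\<in>unit_cube. \<bar>W (x - z)\<bar> \<le> C))"

lemma kernel_bound:
  "0 < kernel_bound" "\<lbrakk>x \<in> unit_cube; z \<in> unit_cube\<rbrakk> \<Longrightarrow> \<bar>W (x - z)\<bar> \<le> kernel_bound"
proof -
  have "compact ((\<lambda>p. W (fst p - snd p)) ` (unit_cube \<times> unit_cube))"
    by (rule compact_continuous_image[OF uniformly_continuous_imp_continuous[OF
        uniformly_continuous_kernel] compact_Times[OF compact_unit_cube compact_unit_cube]])
  then obtain C where "0 < C" "\<forall>y \<in> (\<lambda>p. W (fst p - snd p)) ` (unit_cube \<times> unit_cube). norm y \<le> C"
    using compact_imp_bounded[THEN bounded_pos[THEN iffD1]] by blast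
  then have "\<exists>C. 0 < C \<and> (\<forall>x\<in>unit_cube. \<forall>z\<in>unit_cube. \<bar>W (x - z)\<bar> \<le> C)"
    by (intro exI[of _ C]) (simp add: image_iff)
  from someI_ex[OF this]
  show "0 < kernel_bound" "\<lbrakk>x \<in> unit_cube; z \<in> unit_cube\<rbrakk> \<Longrightarrow> \<bar>W (x - z)\<bar> \<le> kernel_bound"
    unfolding kernel_bound_def by auto
qed

lemma kernel_measurable: "(\<lambda>z. W (x - z)) \<in> borel_measurable torus_measure"
  by (intro continuous_imp_measurable_on_sets_lebesgue unit_cube_sets)
    (intro continuous_on_compose2[OF continuous_W] continuous_intros subset_UNIV)

lemma
  assumes "integrable torus_measure \<rho>" "x \<in> unit_cube"
  shows integrable_kernel: "integrable torus_measure (\<lambda>z. W (x - z) * \<rho> z)"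
    and convolution_bound: "\<bar>torus_convolution W \<rho> x\<bar> \<le> kernel_bound * (\<integral>z. \<bar>\<rho> z\<bar> \<partial>torus_measure)"
  unfolding torus_convolution_def torus_integral_eq
  using assms by (auto intro!: integrable_bounded_mult kernel_measurable kernel_bound simp: space_restrict_space)

text \<open>Uniform continuity of the kernel yields a \<open>d\<close> chosen before the density.
  This order of quantifiers is what Arzela--Ascoli requires.\<close>

lemma convolution_equicontinuous:
  fixes e :: real
  assumes "0 < e"
  obtains d where "0 < d"
    and "\<And>(\<rho> :: real ^ 'd \<Rightarrow> real) x y. \<lbrakk>integrable torus_measure \<rho>; x \<in> unit_cube; y \<in> unit_cube; norm (x - y) < d\<rbrakk>
      \<Longrightarrow> \<bar>torus_convolution W \<rho> x - torus_convolution W \<rho> y\<bar> \<le> e * (\<integral>z. \<bar>\<rho> z\<bar> \<partial>torus_measure)"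
proof -
  obtain d where d: "0 < d" and *: "\<And>p q. \<lbrakk>p \<in> unit_cube \<times> unit_cube; q \<in> unit_cube \<times> unit_cube; dist q p < d\<rbrakk>
      \<Longrightarrow> dist (W (fst q - snd q)) (W (fst p - snd p)) < e"
    using uniformly_continuous_kernel assms unfolding uniformly_continuous_on_def by metis
  show thesis
  proof (rule that[OF d])
    fix \<rho> :: "real ^ 'd \<Rightarrow> real" and x y :: "real ^ 'd"
    assume \<rho>: "integrable torus_measure \<rho>" and xy: "x \<in> unit_cube" "y \<in> unit_cube" "norm (x - y) < d"
    have "\<bar>W (x - z) - W (y - z)\<bar> \<le> e" if "z \<in> unit_cube" for z
      using *[of "(y, z)" "(x, z)"] xy that by (simp add: dist_Pair_Pair dist_norm)
    then have "\<bar>\<integral>z. (W (x - z) - W (y - z)) * \<rho> z \<partial>torus_measure\<bar> \<le> e * (\<integral>z. \<bar>\<rho> z\<bar> \<partial>torus_measure)"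
      using \<rho> by (intro integrable_bounded_mult borel_measurable_diff kernel_measurable)
        (auto simp: space_restrict_space)
    then show "\<bar>torus_convolution W \<rho> x - torus_convolution W \<rho> y\<bar> \<le> e * (\<integral>z. \<bar>\<rho> z\<bar> \<partial>torus_measure)"
      using integrable_kernel[OF \<rho>] xy
      by (simp add: torus_convolution_def torus_integral_eq left_diff_distrib)
  qed
qed

lemma continuous_on_convolution:
  assumes \<rho>: "integrable torus_measure \<rho>"
  shows "continuous_on unit_cube (torus_convolution W \<rho>)"
  unfolding continuous_on_iff
proof (intro ballI allI impI)
  fix x e :: real and y :: "real ^ 'd" assume y: "y \<in> unit_cube" and e: "0 < e"
  define I where "I = (\<integral>z. \<bar>\<rho> z\<bar> \<partial>torus_measure)"
  have I: "0 \<le> I" by (simp add: I_def)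
  \<comment> \<open>Dividing by \<open>I + 1\<close> instead of \<open>I\<close> covers
    \<open>I = 0\<close> and makes the resulting bound strict.\<close>
  obtain d where "0 < d" and d: "\<And>(\<rho> :: real ^ 'd \<Rightarrow> real) x y. \<lbrakk>integrable torus_measure \<rho>; x \<in> unit_cube; y \<in> unit_cube; norm (x - y) < d\<rbrakk>
      \<Longrightarrow> \<bar>torus_convolution W \<rho> x - torus_convolution W \<rho> y\<bar> \<le> (e / (I + 1)) * (\<integral>z. \<bar>\<rho> z\<bar> \<partial>torus_measure)"
    using convolution_equicontinuous[of "e / (I + 1)"] e I by auto
  have "e / (I + 1) * I < e"
    using e I by (simp add: field_simps)
  with \<open>0 < d\<close> d[OF \<rho>] y
  show "\<exists>d>0. \<forall>x'\<in>unit_cube. dist x' y < d \<longrightarrow> dist (torus_convolution W \<rho> x') (torus_convolution W \<rho> y) < e"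
    unfolding I_def[symmetric] dist_norm real_norm_def by (meson le_less_trans)
qed

lemma convolution_measurable:
  "integrable torus_measure \<rho> \<Longrightarrow> torus_convolution W \<rho> \<in> borel_measurable torus_measure"
  by (intro continuous_imp_measurable_on_sets_lebesgue unit_cube_sets continuous_on_convolution)

lemma
  assumes "integrable torus_measure \<sigma>" "integrable torus_measure \<tau>"
  shows integrable_interaction: "integrable torus_measure (\<lambda>x. torus_convolution W \<tau> x * \<sigma> x)"
    and interaction_bound: "\<bar>interaction W \<sigma> \<tau>\<bar> \<le>
      kernel_bound * (\<integral>x. \<bar>\<tau> x\<bar> \<partial>torus_measure) * (\<integral>x. \<bar>\<sigma> x\<bar> \<partial>torus_measure)"
  unfolding interaction_def
  using assms by (auto intro!: integrable_bounded_mult convolution_measurable convolution_bound simp: space_restrict_space)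

lemma interaction_lincomb_left:
  assumes "integrable torus_measure \<sigma>" "integrable torus_measure \<tau>" "integrable torus_measure \<omega>"
  shows "interaction W (\<lambda>x. a * \<sigma> x + b * \<tau> x) \<omega> = a * interaction W \<sigma> \<omega> + b * interaction W \<tau> \<omega>"
  unfolding interaction_def
  using integrable_interaction[OF assms(1,3)] integrable_interaction[OF assms(2,3)]
  by (simp add: distrib_left mult.left_commute)

lemma convolution_lincomb:
  assumes "integrable torus_measure \<sigma>" "integrable torus_measure \<tau>" "x \<in> unit_cube"
  shows "torus_convolution W (\<lambda>x. a * \<sigma> x + b * \<tau> x) x
    = a * torus_convolution W \<sigma> x + b * torus_convolution W \<tau> x"
  unfolding torus_convolution_def torus_integral_eq
  using integrable_kernel[OF assms(1,3)] integrable_kernel[OF assms(2,3)]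
  by (simp add: distrib_left mult.left_commute)

lemma interaction_lincomb_right:
  assumes "integrable torus_measure \<sigma>" "integrable torus_measure \<tau>" "integrable torus_measure \<omega>"
  shows "interaction W \<omega> (\<lambda>x. a * \<sigma> x + b * \<tau> x) = a * interaction W \<omega> \<sigma> + b * interaction W \<omega> \<tau>"
proof -
  have "interaction W \<omega> (\<lambda>x. a * \<sigma> x + b * \<tau> x) =
    (\<integral>x. a * (torus_convolution W \<sigma> x * \<omega> x) + b * (torus_convolution W \<tau> x * \<omega> x) \<partial>torus_measure)"
    unfolding interaction_def using assms
    by (intro Bochner_Integration.integral_cong refl)
      (simp add: convolution_lincomb space_restrict_space algebra_simps)
  then show ?thesis
    unfolding interaction_def
    using integrable_interaction[OF assms(3,1)] integrable_interaction[OF assms(3,2)] by simp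
qed

text \<open>The midpoint energy is the average of four interactions, so it is close to
  \<open>c\<close> once all four are.\<close>

lemma interaction_midpoint:
  assumes "integrable torus_measure \<sigma>" "integrable torus_measure \<tau>"
  shows "interaction W (\<lambda>x. (\<sigma> x + \<tau> x) / 2) (\<lambda>x. (\<sigma> x + \<tau> x) / 2)
    = (interaction W \<sigma> \<sigma> + interaction W \<sigma> \<tau> + interaction W \<tau> \<sigma> + interaction W \<tau> \<tau>) / 4"
proof -
  have *: "(\<lambda>x. (\<sigma> x + \<tau> x) / 2) = (\<lambda>x. (1/2) * \<sigma> x + (1/2) * \<tau> x)"
    by (simp add: add_divide_distrib)
  have m: "integrable torus_measure (\<lambda>x. (1/2) * \<sigma> x + (1/2) * \<tau> x)" using assms by simp
  show ?thesis
    unfolding * interaction_lincomb_left[OF assms m]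
      interaction_lincomb_right[OF assms assms(1)] interaction_lincomb_right[OF assms assms(2)]
    by (simp add: field_simps)
qed

text \<open>The difference splits as \<open>interaction W (\<sigma> - \<tau>) \<sigma> + interaction
  W \<tau> (\<sigma> - \<tau>)\<close>. It follows that the interaction is continuous in
  \<open>L\<^sup>1\<close> on bounded sets.\<close>

lemma interaction_diff_bound:
  assumes "integrable torus_measure \<sigma>" "integrable torus_measure \<tau>"
  shows "\<bar>interaction W \<sigma> \<sigma> - interaction W \<tau> \<tau>\<bar> \<le> kernel_bound *
    ((\<integral>x. \<bar>\<sigma> x\<bar> \<partial>torus_measure) + (\<integral>x. \<bar>\<tau> x\<bar> \<partial>torus_measure)) * (\<integral>x. \<bar>\<sigma> x - \<tau> x\<bar> \<partial>torus_measure)"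
proof -
  have d: "integrable torus_measure (\<lambda>x. \<sigma> x - \<tau> x)" using assms by simp
  have "interaction W (\<lambda>x. \<sigma> x - \<tau> x) \<sigma> = interaction W \<sigma> \<sigma> - interaction W \<tau> \<sigma>"
    using interaction_lincomb_left[OF assms assms(1), of 1 "-1"] by simp
  moreover have "interaction W \<tau> (\<lambda>x. \<sigma> x - \<tau> x) = interaction W \<tau> \<sigma> - interaction W \<tau> \<tau>"
    using interaction_lincomb_right[OF assms assms(2), of 1 "-1"] by simp
  ultimately show ?thesis
    using interaction_bound[OF d assms(1)] interaction_bound[OF assms(2) d]
    by (simp add: algebra_simps)
qed

text \<open>Convolution with \<open>W\<close> is compact from \<open>L\<^sup>1\<close> to continuous
  functions. Replacing the convolution of the second density by its uniform limit \<open>u\<close>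
  costs an error small in \<open>j\<close> uniformly in \<open>i\<close>; what remains depends on
  \<open>i\<close> alone and converges. Hence \<open>i\<close> and \<open>j\<close> may tend to
  infinity independently.\<close>

lemma interaction_compactness:
  fixes \<rho> :: "nat \<Rightarrow> real ^ 'd \<Rightarrow> real"
  assumes int: "\<And>n. integrable torus_measure (\<rho> n)"
    and M: "\<And>n. (\<integral>x. \<bar>\<rho> n x\<bar> \<partial>torus_measure) \<le> M"
  obtains r c where "strict_mono (r :: nat \<Rightarrow> nat)"
    and "\<And>e. 0 < e \<Longrightarrow> \<exists>N. \<forall>i\<ge>N. \<forall>j\<ge>N. \<bar>interaction W (\<rho> (r i)) (\<rho> (r j)) - c\<bar> < e"
proof -
  have M0: "0 \<le> M"
    using order_trans[OF _ M[of 0]] by simp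
  have bound: "norm (torus_convolution W (\<rho> n) x) \<le> kernel_bound * M" if "x \<in> unit_cube" for n x
    using convolution_bound[OF int that, of n] M[of n] kernel_bound(1)
    by (simp add: order_trans[OF _ mult_left_mono])
  obtain u k where u: "continuous_on unit_cube u" and k: "strict_mono (k :: nat \<Rightarrow> nat)"
    and unif: "\<And>e. 0 < e \<Longrightarrow>
      \<exists>N. \<forall>n x. N \<le> n \<and> x \<in> unit_cube \<longrightarrow> norm (torus_convolution W (\<rho> (k n)) x - u x) < e"
  proof (rule Arzela_Ascoli[OF compact_unit_cube bound])
    fix x :: "real ^ 'd" and e :: real assume x: "x \<in> unit_cube" and e: "0 < e"
    obtain d where "0 < d" and d: "\<And>(\<rho> :: real ^ 'd \<Rightarrow> real) x y. \<lbrakk>integrable torus_measure \<rho>; x \<in> unit_cube; y \<in> unit_cube; norm (x - y) < d\<rbrakk>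
      \<Longrightarrow> \<bar>torus_convolution W \<rho> x - torus_convolution W \<rho> y\<bar> \<le> (e / (M + 1)) * (\<integral>z. \<bar>\<rho> z\<bar> \<partial>torus_measure)"
      using convolution_equicontinuous[of "e / (M + 1)"] e M0 by auto
    have "(e / (M + 1)) * (\<integral>z. \<bar>\<rho> n z\<bar> \<partial>torus_measure) < e" for n
    proof -
      have "(e / (M + 1)) * (\<integral>z. \<bar>\<rho> n z\<bar> \<partial>torus_measure) \<le> (e / (M + 1)) * M"
        using e M0 M by (intro mult_left_mono) auto
      also have "\<dots> < e" using e M0 by (simp add: field_simps)
      finally show ?thesis .
    qed
    with \<open>0 < d\<close> d[OF int x]
    show "\<exists>d. 0 < d \<and> (\<forall>n y. y \<in> unit_cube \<and> norm (x - y) < d \<longrightarrow>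
        norm (torus_convolution W (\<rho> n) x - torus_convolution W (\<rho> n) y) < e)"
      unfolding real_norm_def by (meson le_less_trans)
  qed (assumption, rule that)
  have u_meas: "u \<in> borel_measurable torus_measure"
    by (intro continuous_imp_measurable_on_sets_lebesgue unit_cube_sets u)
  obtain K where K: "\<And>x. x \<in> unit_cube \<Longrightarrow> \<bar>u x\<bar> \<le> K"
    using compact_imp_bounded[OF compact_continuous_image[OF u compact_unit_cube]]
    unfolding bounded_iff by auto
  have K0: "0 \<le> K"
    using K[of 0] by (simp add: unit_cube_def mem_box_cart)
  note u_mult = integrable_bounded_mult[OF int u_meas, of K]
  \<comment> \<open>Pairing with the single function \<open>u\<close> gives a bounded real sequence,
    so Bolzano--Weierstrass suffices here.\<close>
  define a where "a n = (\<integral>x. u x * \<rho> (k n) x \<partial>torus_measure)" for n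
  have "\<bar>a n\<bar> \<le> K * M" for n
    unfolding a_def using u_mult(2)[of "k n"] K K0 M[of "k n"]
    by (fastforce simp: space_restrict_space intro: order_trans mult_left_mono)
  then have "bounded (range a)"
    unfolding bounded_iff by auto
  then obtain c q where q: "strict_mono (q :: nat \<Rightarrow> nat)" and c: "(a \<circ> q) \<longlonglongrightarrow> c"
    using bounded_imp_convergent_subsequence by blast
  show thesis
  proof (rule that[of "k \<circ> q" c])
    show "strict_mono (k \<circ> q)" using k q by (simp add: strict_mono_o)
    fix e :: real assume e: "0 < e"
    obtain N1 where N1: "\<And>n. N1 \<le> n \<Longrightarrow> \<bar>a (q n) - c\<bar> < e / 2"
      using LIMSEQ_D[OF c, of "e / 2"] e by auto
    \<comment> \<open>After multiplication by a mass of at most \<open>M\<close> this error stays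
      below \<open>e / 2\<close>.\<close>
    obtain N2 where N2: "\<And>n x. \<lbrakk>N2 \<le> n; x \<in> unit_cube\<rbrakk>
        \<Longrightarrow> \<bar>torus_convolution W (\<rho> (k n)) x - u x\<bar> < e / (2 * (M + 1))"
      using unif[of "e / (2 * (M + 1))"] e M0 by auto
    show "\<exists>N. \<forall>i\<ge>N. \<forall>j\<ge>N. \<bar>interaction W (\<rho> ((k \<circ> q) i)) (\<rho> ((k \<circ> q) j)) - c\<bar> < e"
    proof (intro exI allI impI)
      fix i j assume ij: "max N1 N2 \<le> i" "max N1 N2 \<le> j"
      let ?\<sigma> = "\<rho> (k (q i))" and ?\<tau> = "\<rho> (k (q j))"
      \<comment> \<open>\<open>N2\<close> counts along \<open>k\<close> and \<open>N1\<close> along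
        \<open>k \<circ> q\<close>, so only \<open>N2\<close> has to be moved through
        \<open>q\<close>.\<close>
      have "N2 \<le> q j" using ij seq_suble[OF q, of j] by simp
      then have "\<bar>torus_convolution W ?\<tau> x - u x\<bar> \<le> e / (2 * (M + 1))" if "x \<in> unit_cube" for x
        using N2[OF _ that] by (intro less_imp_le)
      then have "\<bar>\<integral>x. (torus_convolution W ?\<tau> x - u x) * ?\<sigma> x \<partial>torus_measure\<bar>
          \<le> e / (2 * (M + 1)) * (\<integral>x. \<bar>?\<sigma> x\<bar> \<partial>torus_measure)"
        by (intro integrable_bounded_mult int borel_measurable_diff convolution_measurable u_meas)
          (simp add: space_restrict_space)
      also have "\<dots> \<le> e / (2 * (M + 1)) * M"
        using e M0 M by (intro mult_left_mono) auto
      also have "\<dots> < e / 2"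
        using e M0 by (simp add: field_simps)
      finally have "\<bar>\<integral>x. (torus_convolution W ?\<tau> x - u x) * ?\<sigma> x \<partial>torus_measure\<bar> < e / 2" .
      moreover have "(\<integral>x. (torus_convolution W ?\<tau> x - u x) * ?\<sigma> x \<partial>torus_measure)
          = interaction W ?\<sigma> ?\<tau> - a (q i)"
        unfolding interaction_def a_def
        using integrable_interaction[OF int int] u_mult(1) K
        by (simp add: left_diff_distrib space_restrict_space)
      moreover have "\<bar>a (q i) - c\<bar> < e / 2" using N1 ij by simp
      ultimately show "\<bar>interaction W (\<rho> ((k \<circ> q) i)) (\<rho> ((k \<circ> q) j)) - c\<bar> < e"
        unfolding comp_def by linarith
    qed
  qed
qed

end

section \<open>Admissible densities and their entropy\<close>

lemma torus_measure_integrable_const: "integrable torus_measure (\<lambda>x. a)" for a :: real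
  using finite_measure.integrable_const[OF finite_measure_torus_measure] .

lemma
  fixes f :: "real ^ 'd \<Rightarrow> real"
  assumes "integrable torus_measure f"
  shows torus_measure_integrable_add_const: "integrable torus_measure (\<lambda>x. f x + a)"
    and torus_measure_integral_add_const:
      "(\<integral>x. f x + a \<partial>torus_measure) = integral\<^sup>L torus_measure f + a"
  using Bochner_Integration.integrable_add[OF assms torus_measure_integrable_const[of a]]
    Bochner_Integration.integral_add[OF assms torus_measure_integrable_const[of a]]
  by (simp_all add: measure_torus_measure)

lemma entropy_density_eq: "t * ln t = entropy_density t + t"
  by (simp add: entropy_density_def algebra_simps)

text \<open>The integrands \<open>\<sigma> * ln \<sigma>\<close> and
  \<open>entropy_density \<sigma>\<close> differ by \<open>\<sigma>\<close>, which is integrable, so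
  the entropy condition can be stated for the convex function used throughout.\<close>

lemma admissible_iff:
  "\<sigma> \<in> admissible M \<longleftrightarrow> torus_periodic \<sigma> \<and> (AE x in lebesgue. 0 \<le> \<sigma> x) \<and>
    integrable torus_measure \<sigma> \<and> integral\<^sup>L torus_measure \<sigma> = M \<and>
    integrable torus_measure (\<lambda>x. entropy_density (\<sigma> x))"
proof (cases "integrable torus_measure \<sigma>")
  case True
  have "integrable torus_measure (\<lambda>x. \<sigma> x * ln (\<sigma> x)) \<longleftrightarrow> integrable torus_measure (\<lambda>x. entropy_density (\<sigma> x))"
    unfolding entropy_density_eq
  proof
    assume "integrable torus_measure (\<lambda>x. entropy_density (\<sigma> x) + \<sigma> x)"
    from Bochner_Integration.integrable_diff[OF this True]
    show "integrable torus_measure (\<lambda>x. entropy_density (\<sigma> x))" by simp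
  qed (rule Bochner_Integration.integrable_add[OF _ True])
  then show ?thesis
    by (auto simp: admissible_def torus_L1_def set_integrable_unit_cube torus_integral_eq)
next
  case False
  then show ?thesis
    by (simp add: admissible_def torus_L1_def set_integrable_unit_cube)
qed

lemma admissibleD:
  assumes "\<sigma> \<in> admissible M"
  shows "torus_periodic \<sigma>" "AE x in lebesgue. 0 \<le> \<sigma> x" "AE x in torus_measure. 0 \<le> \<sigma> x"
    "integrable torus_measure \<sigma>" "integral\<^sup>L torus_measure \<sigma> = M"
    "integrable torus_measure (\<lambda>x. entropy_density (\<sigma> x))"
  using assms AE_torus_measure unfolding admissible_iff by blast+

lemma admissible_L1_norm:
  assumes "\<sigma> \<in> admissible M"
  shows "(\<integral>x. \<bar>\<sigma> x\<bar> \<partial>torus_measure) = M"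
proof -
  have "(\<integral>x. \<bar>\<sigma> x\<bar> \<partial>torus_measure) = integral\<^sup>L torus_measure \<sigma>"
    using admissibleD(3,4)[OF assms] by (intro integral_cong_AE) auto
  then show ?thesis using admissibleD[OF assms] by simp
qed

text \<open>A competitor showing that the infimum is taken over a nonempty class.\<close>

lemma const_admissible: "0 \<le> M \<Longrightarrow> (\<lambda>x. M) \<in> admissible M"
  by (simp add: admissible_iff torus_periodic_def torus_measure_integrable_const measure_torus_measure)

definition entropy :: "(real ^ 'd \<Rightarrow> real) \<Rightarrow> real"
  where "entropy \<sigma> = (\<integral>x. entropy_density (\<sigma> x) \<partial>torus_measure)"

lemma free_energy_eq: "free_energy \<beta> W \<sigma> = entropy \<sigma> - \<beta> * interaction W \<sigma> \<sigma>"
  by (simp add: free_energy_def entropy_def interaction_def torus_integral_eq entropy_density_def mult.commute)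

lemma entropy_ge:
  fixes \<sigma> :: "real ^ 'd \<Rightarrow> real"
  assumes "\<sigma> \<in> admissible M"
  shows "- 1 \<le> entropy \<sigma>"
proof -
  have "(\<integral>x. - 1 \<partial>(torus_measure :: (real ^ 'd) measure)) \<le> entropy \<sigma>"
    unfolding entropy_def
  proof (rule integral_mono_AE[OF torus_measure_integrable_const admissibleD(6)[OF assms]])
    show "AE x in torus_measure. - 1 \<le> entropy_density (\<sigma> x)"
      using admissibleD(3)[OF assms] by eventually_elim (rule entropy_density_ge)
  qed
  then show ?thesis by (simp add: measure_torus_measure)
qed

text \<open>The entropy density of the midpoint lies above \<open>- 1\<close> and, by convexity,
  below the mean of the two given ones; this provides an integrable majorant.\<close>

lemma midpoint_admissible:
  assumes "\<sigma> \<in> admissible M" "\<tau> \<in> admissible M"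
  shows "(\<lambda>x. (\<sigma> x + \<tau> x) / 2) \<in> admissible M"
proof -
  note \<sigma> = admissibleD[OF assms(1)] and \<tau> = admissibleD[OF assms(2)]
  have [measurable]: "\<sigma> \<in> borel_measurable torus_measure" "\<tau> \<in> borel_measurable torus_measure"
    using \<sigma> \<tau> by auto
  have "integrable torus_measure (\<lambda>x. \<bar>entropy_density (\<sigma> x)\<bar> + \<bar>entropy_density (\<tau> x)\<bar> + 1)"
    by (intro Bochner_Integration.integrable_add integrable_abs \<sigma> \<tau> torus_measure_integrable_const)
  moreover have "(\<lambda>x. entropy_density ((\<sigma> x + \<tau> x) / 2)) \<in> borel_measurable torus_measure"
    by measurable
  moreover have "AE x in torus_measure. norm (entropy_density ((\<sigma> x + \<tau> x) / 2))
      \<le> norm (\<bar>entropy_density (\<sigma> x)\<bar> + \<bar>entropy_density (\<tau> x)\<bar> + 1)"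
    using \<sigma>(3) \<tau>(3)
  proof eventually_elim
    case (elim x)
    then have "entropy_density ((\<sigma> x + \<tau> x) / 2) \<ge> - 1"
      by (intro entropy_density_ge) simp
    moreover have "0 \<le> entropy_density (\<sigma> x) + entropy_density (\<tau> x) - 2 * entropy_density ((\<sigma> x + \<tau> x) / 2)"
      by (rule order_trans[OF _ entropy_density_midpoint[OF elim]]) simp
    ultimately show ?case by simp
  qed
  ultimately have "integrable torus_measure (\<lambda>x. entropy_density ((\<sigma> x + \<tau> x) / 2))"
    by (rule Bochner_Integration.integrable_bound)
  moreover have "AE x in lebesgue. 0 \<le> (\<sigma> x + \<tau> x) / 2"
    using \<sigma>(2) \<tau>(2) by eventually_elim simp
  ultimately show ?thesis
    using \<sigma> \<tau> unfolding admissible_iff torus_periodic_def by simp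
qed

text \<open>The pointwise estimate \<open>abs_diff_le_entropy_gap\<close> integrated; both densities
  have mass \<open>M\<close>, which gives the term \<open>4 * t * M\<close>.\<close>

lemma L1_dist_le_entropy_gap:
  assumes "\<sigma> \<in> admissible M" "\<tau> \<in> admissible M" "0 < t"
  shows "(\<integral>x. \<bar>\<sigma> x - \<tau> x\<bar> \<partial>torus_measure)
    \<le> (entropy \<sigma> + entropy \<tau> - 2 * entropy (\<lambda>x. (\<sigma> x + \<tau> x) / 2)) / (2 * t) + 4 * t * M"
proof -
  let ?\<mu> = "\<lambda>x. (\<sigma> x + \<tau> x) / 2"
  note \<sigma> = admissibleD[OF assms(1)] and \<tau> = admissibleD[OF assms(2)]
    and \<mu> = admissibleD[OF midpoint_admissible[OF assms(1,2)]]
  have "(\<integral>x. \<bar>\<sigma> x - \<tau> x\<bar> \<partial>torus_measure) \<le> (\<integral>x. (entropy_density (\<sigma> x) + entropy_density (\<tau> x)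
      - 2 * entropy_density (?\<mu> x)) / (2 * t) + 2 * t * (\<sigma> x + \<tau> x) \<partial>torus_measure)"
  proof (rule integral_mono_AE)
    show "AE x in torus_measure. \<bar>\<sigma> x - \<tau> x\<bar> \<le> (entropy_density (\<sigma> x) + entropy_density (\<tau> x)
      - 2 * entropy_density (?\<mu> x)) / (2 * t) + 2 * t * (\<sigma> x + \<tau> x)"
      using \<sigma>(3) \<tau>(3) by eventually_elim (rule abs_diff_le_entropy_gap[OF _ _ assms(3)])
  qed (use \<sigma> \<tau> \<mu> in auto)
  also have "\<dots> = (entropy \<sigma> + entropy \<tau> - 2 * entropy ?\<mu>) / (2 * t) + 2 * t * (M + M)"
    unfolding entropy_def using \<sigma> \<tau> \<mu>(6) by simp
  finally show ?thesis by simp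
qed

lemma torus_periodic_seq_limit:
  "(\<And>n. torus_periodic (s n)) \<Longrightarrow> torus_periodic (seq_limit s)"
  by (simp add: torus_periodic_def seq_limit_def)

lemma seq_limit_nonneg:
  assumes "\<And>n. 0 \<le> s n x"
  shows "0 \<le> seq_limit s x"
  using assms by (auto simp: seq_limit_def convergent_LIMSEQ_iff intro: LIMSEQ_le_const)

section \<open>Minimizing sequences\<close>

context torus_kernel
begin

text \<open>Entropy is at least \<open>- 1\<close>, and the interaction is controlled by the fixed
  mass. The infimum is therefore a real number.\<close>

lemma free_energy_ge:
  assumes "0 \<le> \<beta>" "\<sigma> \<in> admissible M"
  shows "- 1 - \<beta> * (kernel_bound * M * M) \<le> free_energy \<beta> W \<sigma>"
proof -
  have "interaction W \<sigma> \<sigma> \<le> kernel_bound * M * M"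
    using interaction_bound[of \<sigma> \<sigma>] admissibleD[OF assms(2)] admissible_L1_norm[OF assms(2)] by simp
  then have "\<beta> * interaction W \<sigma> \<sigma> \<le> \<beta> * (kernel_bound * M * M)"
    using assms(1) by (rule mult_left_mono)
  then show ?thesis
    using entropy_ge[OF assms(2)] by (simp add: free_energy_eq)
qed

text \<open>With all interactions close to \<open>c\<close>, near-minimality of two terms and the
  lower bound \<open>m\<close> at their midpoint leave only a small entropy gap, which controls the
  \<open>L\<^sup>1\<close> distance.\<close>

lemma minimizing_sequence_L1_Cauchy:
  fixes \<rho> :: "nat \<Rightarrow> real ^ 'd \<Rightarrow> real"
  assumes "0 < \<beta>" "0 < M" and adm: "\<And>n. \<rho> n \<in> admissible M"
    and lower: "\<And>\<sigma>. \<sigma> \<in> admissible M \<Longrightarrow> m \<le> free_energy \<beta> W \<sigma>"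
    and minimizing: "\<And>e. 0 < e \<Longrightarrow> \<exists>N. \<forall>n\<ge>N. free_energy \<beta> W (\<rho> n) < m + e"
    and mixed: "\<And>e. 0 < e \<Longrightarrow> \<exists>N. \<forall>i\<ge>N. \<forall>j\<ge>N. \<bar>interaction W (\<rho> i) (\<rho> j) - c\<bar> < e"
    and "0 < e"
  shows "\<exists>N. \<forall>i\<ge>N. \<forall>j\<ge>N. (\<integral>x. \<bar>\<rho> i x - \<rho> j x\<bar> \<partial>torus_measure) < e"
proof -
  \<comment> \<open>The mass term then contributes \<open>e / 4\<close>.\<close>
  define t where "t = e / (16 * M)"
  have t: "0 < t" "4 * t * M = e / 4" using assms by (auto simp: t_def)
  \<comment> \<open>Chosen so that the entropy gap, at most
    \<open>2 * (1 + 2 * \<beta>) * h\<close>, equals \<open>t * e\<close> at worst and contributes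
    \<open>e / 2\<close> after division by \<open>2 * t\<close>. The total is
    \<open>3 * e / 4\<close>.\<close>
  define h where "h = t * e / (2 * (1 + 2 * \<beta>))"
  have h: "0 < h" using assms t by (simp add: h_def)
  obtain N1 where N1: "\<And>n. N1 \<le> n \<Longrightarrow> free_energy \<beta> W (\<rho> n) < m + h"
    using minimizing[OF h] by auto
  obtain N2 where N2: "\<And>i j. \<lbrakk>N2 \<le> i; N2 \<le> j\<rbrakk> \<Longrightarrow> \<bar>interaction W (\<rho> i) (\<rho> j) - c\<bar> < h"
    using mixed[OF h] by blast
  show ?thesis
  proof (intro exI allI impI)
    fix i j assume "max N1 N2 \<le> i" "max N1 N2 \<le> j"
    then have ij: "N1 \<le> i" "N1 \<le> j" "N2 \<le> i" "N2 \<le> j" by auto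
    let ?\<mu> = "\<lambda>x. (\<rho> i x + \<rho> j x) / 2"
    let ?B = "\<lambda>i j. interaction W (\<rho> i) (\<rho> j)"
    have B: "?B i i < c + h" "?B j j < c + h" "c - h < ?B i i" "c - h < ?B j j" "c - h < ?B i j" "c - h < ?B j i"
      using N2[OF ij(3) ij(3)] N2[OF ij(4) ij(4)] N2[OF ij(3) ij(4)] N2[OF ij(4) ij(3)] by linarith+
    have "c - h \<le> interaction W ?\<mu> ?\<mu>"
      using B unfolding interaction_midpoint[OF admissibleD(4)[OF adm] admissibleD(4)[OF adm]] by simp
    then have "\<beta> * (c - h) \<le> \<beta> * interaction W ?\<mu> ?\<mu>"
      using assms(1) by (intro mult_left_mono) auto
    \<comment> \<open>The midpoint is itself a competitor, so its free energy is at least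
      \<open>m\<close>.\<close>
    then have "m + \<beta> * (c - h) \<le> entropy ?\<mu>"
      using lower[OF midpoint_admissible[OF adm[of i] adm[of j]]] by (simp add: free_energy_eq)
    moreover have "entropy (\<rho> k) \<le> m + h + \<beta> * (c + h)" if "N1 \<le> k" "?B k k < c + h" for k
    proof -
      have "\<beta> * ?B k k \<le> \<beta> * (c + h)"
        using that(2) assms(1) by (intro mult_left_mono) auto
      then show ?thesis
        using N1[OF that(1)] by (simp add: free_energy_eq)
    qed
    from this[OF ij(1) B(1)] this[OF ij(2) B(2)]
    have "entropy (\<rho> i) + entropy (\<rho> j) \<le> 2 * (m + h + \<beta> * (c + h))"
      unfolding mult_2 by (rule add_mono)
    ultimately have "entropy (\<rho> i) + entropy (\<rho> j) - 2 * entropy ?\<mu> \<le> 2 * (1 + 2 * \<beta>) * h"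
      by (simp add: algebra_simps)
    also have "\<dots> = t * e"
      using assms(1) by (simp add: h_def)
    finally have "(entropy (\<rho> i) + entropy (\<rho> j) - 2 * entropy ?\<mu>) / (2 * t) \<le> t * e / (2 * t)"
      using t by (intro divide_right_mono) auto
    also have "\<dots> = e / 2" using t by simp
    finally show "(\<integral>x. \<bar>\<rho> i x - \<rho> j x\<bar> \<partial>torus_measure) < e"
      using L1_dist_le_entropy_gap[OF adm[of i] adm[of j] t(1)] t(2) \<open>0 < e\<close> by linarith
  qed
qed

end

section \<open>Existence of a minimizer\<close>

theorem proposition2:
  fixes \<beta> M :: real and W :: "real ^ 'd \<Rightarrow> real"
  assumes "\<beta> > 0" and "M > 0"
    and "W \<in> torus_C" and "radially_symmetric W"
  shows "\<exists>\<rho> \<in> admissible M.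
    ereal (free_energy \<beta> W \<rho>) = (INF \<sigma> \<in> admissible M. ereal (free_energy \<beta> W \<sigma>))"
proof -
  interpret torus_kernel W
    using assms(3) by unfold_locales (simp add: torus_C_def)
  define m where "m = (INF \<sigma> \<in> admissible M. free_energy \<beta> W \<sigma>)"
  have nonempty: "admissible M \<noteq> {}"
    using const_admissible[of M] assms(2) by auto
  have bdd: "bdd_below (free_energy \<beta> W ` admissible M)"
    using free_energy_ge[of \<beta>] assms(1) by (intro bdd_belowI2) simp
  have lower: "m \<le> free_energy \<beta> W \<sigma>" if "\<sigma> \<in> admissible M" for \<sigma>
    unfolding m_def using bdd that by (rule cINF_lower)
  have "\<exists>\<sigma> \<in> admissible M. free_energy \<beta> W \<sigma> < m + inverse (real (Suc n))" for n
    using cINF_less_iff[OF nonempty bdd, of "m + inverse (real (Suc n))"] by (simp add: m_def)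
  then obtain s where s: "\<And>n. s n \<in> admissible M"
      "\<And>n. free_energy \<beta> W (s n) < m + inverse (real (Suc n))"
    by metis
  obtain r c where r: "strict_mono (r :: nat \<Rightarrow> nat)" and
    mixed: "\<And>e. 0 < e \<Longrightarrow> \<exists>N. \<forall>i\<ge>N. \<forall>j\<ge>N. \<bar>interaction W (s (r i)) (s (r j)) - c\<bar> < e"
    using interaction_compactness[of s M] admissibleD(4)[OF s(1)] admissible_L1_norm[OF s(1)]
    by (metis order_refl)
  define \<rho> where "\<rho> n = s (r n)" for n
  note mixed = mixed[folded \<rho>_def]
  have adm: "\<rho> n \<in> admissible M" for n using s by (simp add: \<rho>_def)
  have minimizing: "\<exists>N. \<forall>n\<ge>N. free_energy \<beta> W (\<rho> n) < m + e" if e: "0 < e" for e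
  proof -
    obtain N where N: "inverse (real (Suc N)) < e" using reals_Archimedean[OF e] by blast
    have "free_energy \<beta> W (\<rho> n) < m + e" if "N \<le> n" for n
    proof -
      have "N \<le> r n" using seq_suble[OF r, of n] that by linarith
      then have "inverse (real (Suc (r n))) \<le> inverse (real (Suc N))" by (simp add: le_imp_inverse_le)
      then show ?thesis using s(2)[of "r n"] N unfolding \<rho>_def by linarith
    qed
    then show ?thesis by blast
  qed
  have Cauchy: "\<exists>N. \<forall>i\<ge>N. \<forall>j\<ge>N. (\<integral>x. \<bar>\<rho> i x - \<rho> j x\<bar> \<partial>torus_measure) < e" if "0 < e" for e
    using minimizing_sequence_L1_Cauchy[where \<rho> = \<rho>, OF assms(1,2) adm lower minimizing mixed that] .
  obtain q where q: "strict_mono q" and int: "integrable torus_measure (seq_limit (\<rho> \<circ> q))"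
    and ae: "AE x in torus_measure. (\<lambda>n. \<rho> (q n) x) \<longlonglongrightarrow> seq_limit (\<rho> \<circ> q) x"
    and L1: "(\<lambda>n. \<integral>x. \<bar>\<rho> (q n) x - seq_limit (\<rho> \<circ> q) x\<bar> \<partial>torus_measure) \<longlonglongrightarrow> 0"
    using L1_Cauchy_converges[of torus_measure \<rho>, OF admissibleD(4)[OF adm] Cauchy] by blast
  define g where "g = seq_limit (\<rho> \<circ> q)"
  note int = int[folded g_def] and ae = ae[folded g_def] and L1 = L1[folded g_def]
  have periodic: "torus_periodic g"
    unfolding g_def using admissibleD(1)[OF adm] by (intro torus_periodic_seq_limit) simp
  \<comment> \<open>Convergence is known almost everywhere in the cube only, but
    \<open>seq_limit\<close> is nonnegative wherever all terms are, including points of divergence.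
    This covers the whole space.\<close>
  have "AE x in lebesgue. \<forall>n. 0 \<le> \<rho> n x"
    using admissibleD(2)[OF adm] by (simp add: AE_all_countable)
  then have nonneg: "AE x in lebesgue. 0 \<le> g x"
    by eventually_elim (simp add: g_def seq_limit_nonneg)
  \<comment> \<open>Strong convergence preserves the mass; almost everywhere convergence alone would
    only give at most \<open>M\<close>.\<close>
  have mass: "integral\<^sup>L torus_measure g = M"
  proof -
    have "norm (M - integral\<^sup>L torus_measure g) \<le> (\<integral>x. \<bar>\<rho> (q n) x - g x\<bar> \<partial>torus_measure)" for n
      using integral_abs_bound[of torus_measure "\<lambda>x. \<rho> (q n) x - g x"] int admissibleD(4,5)[OF adm[of "q n"]]
      by simp
    then have "norm (M - integral\<^sup>L torus_measure g) \<le> 0"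
      by (intro LIMSEQ_le_const[OF L1]) auto
    then show ?thesis by simp
  qed
  have g_norm: "(\<integral>x. \<bar>g x\<bar> \<partial>torus_measure) = M"
  proof -
    have "(\<integral>x. \<bar>g x\<bar> \<partial>torus_measure) = integral\<^sup>L torus_measure g"
      using AE_torus_measure[OF nonneg] int by (intro integral_cong_AE) auto
    then show ?thesis using mass by simp
  qed
  \<comment> \<open>Two limits of the same sequence: \<open>c\<close> as the diagonal of the mixed
    interactions, and \<open>interaction W g g\<close> by continuity in
    \<open>L\<^sup>1\<close>.\<close>
  have interaction_g: "interaction W g g = c"
  proof (rule LIMSEQ_unique)
    have "(\<lambda>n. interaction W (\<rho> n) (\<rho> n)) \<longlonglongrightarrow> c"
      using mixed by (intro LIMSEQ_I) (fastforce simp: real_norm_def)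
    then show "(\<lambda>n. interaction W (\<rho> (q n)) (\<rho> (q n))) \<longlonglongrightarrow> c"
      using LIMSEQ_subseq_LIMSEQ[OF _ q] by (simp add: comp_def)
    have "(\<lambda>n. interaction W (\<rho> (q n)) (\<rho> (q n)) - interaction W g g) \<longlonglongrightarrow> 0"
    proof (rule Lim_null_comparison)
      show "(\<lambda>n. kernel_bound * (M + M) * (\<integral>x. \<bar>\<rho> (q n) x - g x\<bar> \<partial>torus_measure)) \<longlonglongrightarrow> 0"
        using tendsto_mult_left[OF L1] by simp
      show "eventually (\<lambda>n. norm (interaction W (\<rho> (q n)) (\<rho> (q n)) - interaction W g g)
          \<le> kernel_bound * (M + M) * (\<integral>x. \<bar>\<rho> (q n) x - g x\<bar> \<partial>torus_measure)) sequentially"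
        using interaction_diff_bound[OF admissibleD(4)[OF adm] int]
        by (simp add: g_norm admissible_L1_norm[OF adm])
    qed
    then show "(\<lambda>n. interaction W (\<rho> (q n)) (\<rho> (q n))) \<longlonglongrightarrow> interaction W g g"
      by (simp add: LIM_zero_iff)
  qed
  \<comment> \<open>The summand \<open>1\<close> makes the integrands nonnegative, and it
    contributes exactly \<open>1\<close> since the cube has measure \<open>1\<close>.\<close>
  have Fatou: "integrable torus_measure (\<lambda>x. entropy_density (g x) + 1) \<and>
      (\<integral>x. entropy_density (g x) + 1 \<partial>torus_measure) \<le> m + \<beta> * c + e + 1" if "0 < e" for e
  proof -
    \<comment> \<open>One \<open>h\<close> is lost in the free energy and \<open>\<beta> * h\<close>
      in the interaction, together \<open>e\<close>.\<close>
    define h where "h = e / (1 + \<beta>)"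
    have "(1 + \<beta>) * h = e" "0 < h" using that assms(1) by (auto simp: h_def)
    then have h: "0 < h" "h + \<beta> * h = e" by (auto simp: distrib_right)
    obtain N1 where N1: "\<And>n. N1 \<le> n \<Longrightarrow> free_energy \<beta> W (\<rho> n) < m + h"
      using minimizing[OF h(1)] by auto
    obtain N2 where N2: "\<And>i j. \<lbrakk>N2 \<le> i; N2 \<le> j\<rbrakk> \<Longrightarrow> \<bar>interaction W (\<rho> i) (\<rho> j) - c\<bar> < h"
      using mixed[OF h(1)] by blast
    have "entropy (\<rho> (q n)) \<le> m + \<beta> * c + e" if "max N1 N2 \<le> n" for n
    proof -
      have n: "N1 \<le> q n" "N2 \<le> q n" using that seq_suble[OF q, of n] by auto
      have "interaction W (\<rho> (q n)) (\<rho> (q n)) \<le> c + h"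
        using N2[OF n(2) n(2)] by linarith
      then have "\<beta> * interaction W (\<rho> (q n)) (\<rho> (q n)) \<le> \<beta> * (c + h)"
        using assms(1) by (intro mult_left_mono) auto
      then show ?thesis
        using N1[OF n(1)] h(2) by (simp add: free_energy_eq distrib_left)
    qed
    moreover have "(\<integral>x. entropy_density (\<rho> (q n) x) + 1 \<partial>torus_measure) = entropy (\<rho> (q n)) + 1" for n
      unfolding entropy_def by (rule torus_measure_integral_add_const[OF admissibleD(6)[OF adm]])
    ultimately have ev: "eventually (\<lambda>n. (\<integral>x. entropy_density (\<rho> (q n) x) + 1 \<partial>torus_measure)
        \<le> m + \<beta> * c + e + 1) sequentially"
      unfolding eventually_sequentially by (intro exI[of _ "max N1 N2"]) simp
    \<comment> \<open>Continuity of \<open>entropy_density\<close> is established on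
      \<open>{0..}\<close>, so all terms and the limit must be nonnegative at the same
      point.\<close>
    have "AE x in torus_measure. \<forall>n. 0 \<le> \<rho> n x"
      using admissibleD(3)[OF adm] by (simp add: AE_all_countable)
    with ae AE_torus_measure[OF nonneg]
    have lim: "AE x in torus_measure. (\<lambda>n. entropy_density (\<rho> (q n) x) + 1) \<longlonglongrightarrow> entropy_density (g x) + 1"
    proof eventually_elim
      case (elim x)
      then show ?case
        by (intro tendsto_add tendsto_const continuous_on_tendsto_compose[OF continuous_on_entropy_density]) auto
    qed
    have pos: "AE x in torus_measure. 0 \<le> entropy_density (\<rho> (q n) x) + 1" for n
      using admissibleD(3)[OF adm[of "q n"]] by eventually_elim (use entropy_density_ge in fastforce)
    have [measurable]: "g \<in> borel_measurable torus_measure" using int by auto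
    have ui: "integrable torus_measure (\<lambda>x. entropy_density (\<rho> (q n) x) + 1)" for n
      by (rule torus_measure_integrable_add_const[OF admissibleD(6)[OF adm]])
    have "(\<lambda>x. entropy_density (g x) + 1) \<in> borel_measurable torus_measure" by measurable
    from Fatou_real[where u = "\<lambda>n x. entropy_density (\<rho> (q n) x) + 1", OF ui pos lim this ev]
    show ?thesis by blast
  qed
  \<comment> \<open>Integrability needs just one value of \<open>e\<close>; the sharp bound follows
    by letting \<open>e\<close> tend to \<open>0\<close>.\<close>
  have entropy_g: "integrable torus_measure (\<lambda>x. entropy_density (g x))"
    using torus_measure_integrable_add_const[OF conjunct1[OF Fatou[OF zero_less_one]], of "- 1"]
    by simp
  then have "(\<integral>x. entropy_density (g x) + 1 \<partial>torus_measure) = entropy g + 1"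
    unfolding entropy_def by (rule torus_measure_integral_add_const)
  then have "entropy g \<le> m + \<beta> * c + e" if "0 < e" for e
    using Fatou[OF that] by simp
  then have "entropy g \<le> m + \<beta> * c" by (rule field_le_epsilon)
  then have "free_energy \<beta> W g \<le> m"
    by (simp add: free_energy_eq interaction_g)
  then have minimal: "free_energy \<beta> W g \<le> free_energy \<beta> W \<sigma>" if "\<sigma> \<in> admissible M" for \<sigma>
    using lower[OF that] by linarith
  have g: "g \<in> admissible M"
    unfolding admissible_iff using periodic nonneg int mass entropy_g by blast
  show ?thesis
  proof (rule bexI[OF _ g], rule antisym)
    show "ereal (free_energy \<beta> W g) \<le> (INF \<sigma> \<in> admissible M. ereal (free_energy \<beta> W \<sigma>))"
      using minimal by (intro INF_greatest) simp
    show "(INF \<sigma> \<in> admissible M. ereal (free_energy \<beta> W \<sigma>)) \<le> ereal (free_energy \<beta> W g)"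
      using g by (rule INF_lower)
  qed
qed

end
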